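(* Suppose $U=1$, $h=K=0$, and $H=\infty$. There exist absolute constants $C>0$ and $T_0\in\mathbb{Z}_{>0}$ such that for any $b\in(0,1/2]$, $L\in\mathbb{Z}_{\ge 0}$, $T\in\mathbb{Z}_{\ge T_0}$, $\gamma\in(0,b/16]$, and $\underline{H}\le -1$, there exists a probability distribution $\mathcal{D}$ on $[0,U]^{T+L}$ such that, with $\Pi_{(s,S)}=\{(s,S)\in\mathbb{R}^2:\underline{H}\le s\le S,\ S\ge 0\}$, $$\mathbb{E}_{\mathbf{d}_1,\dots,\mathbf{d}_N\sim\mathcal{D}}\big[\mathrm{GE}(\mathcal{L}(\Pi_{(s,S)}))\big]\ge C\gamma\sqrt{\frac{\log T}{N\log\log T}}\qquad\text{for all } N\ge \mathrm{P}_\gamma\text{-}\mathrm{dim}\big(\mathcal{L}(\Pi_{(s,S)})\big).$$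
   Context: Inventory model (backlogged demand, lead time $L$). There are $T+L$ periods; a demand sequence is $\mathbf{d}=(d^1,\dots,d^{T+L})\in[0,U]^{T+L}$. Let $x^t$ be the inventory level at the beginning of period $t$ and $q^t\ge 0$ the quantity ordered in period $t$ (arriving in period $t+L$), with $q^t=0$ for $t\le 0$. The inventory position before ordering is $I^t=x^t+\sum_{t'=t-L}^{t-1}q^{t'}$. After replenishment the inventory level is $y^t=x^t+q^{t-L}$, and $x^{t+1}=y^t-d^t$. Let $c(x)=h\max\{x,0\}+b\max\{-x,0\}$. The loss in period $t$ of a policy $\pi$ is $\ell^t(\pi,\mathbf{d})=c(y^t-d^t)+K\cdot\mathbb{I}\{q^{t-L}>0\}$, and the loss is $\ell(\pi,\mathbf{d})=\frac1T\sum_{t=L+1}^{T+L}\ell^t(\pi,\mathbf{d})$. $(s,S)$ policies: in general $\Pi_{(s,S)}=\{(s,S):\underline{H}\le s\le S\le H,\ S\ge0\}$; the policy $(s,S)$ orders $q^t=(S-I^t)\cdot\mathbb{I}\{I^t\le s\}$ in every period $t\ge 1$. The initial level $x^1$ is a fixed non-positive constant with $x^1\le\underline{H}$. Generalization error: $\mathbf{d}_1,\dots,\mathbf{d}_N$ are i.i.d. from $\mathcal{D}$; $\mathcal{L}(\Pi)=\{\ell(\pi,\cdot):\pi\in\Pi\}$; $R(\pi)=\mathbb{E}_{\mathbf{d}\sim\mathcal{D}}[\ell(\pi,\mathbf{d})]$; $\hat R(\pi)=\frac1N\sum_{i=1}^N\ell(\pi,\mathbf{d}_i)$; $\mathrm{GE}(\mathcal{L}(\Pi))=\sup_{\pi\in\Pi}\{R(\pi)-\hat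 R(\pi)\}$. Pseudo$_\gamma$-dimension: for $\gamma\ge 0$, a dataset $(\mathbf{d}_i)_{i=1}^m$ in $[0,U]^{T+L}$ is $\gamma$-shattered by a class $\{f(\pi,\cdot):\pi\in\Pi\}$ of real-valued functions if there exist $\tau_1,\dots,\tau_m\in\mathbb{R}$ such that for every $A\subseteq\{1,\dots,m\}$ there is $\pi\in\Pi$ with $f(\pi,\mathbf{d}_i)>\tau_i+\gamma$ for all $i\in A$ and $f(\pi,\mathbf{d}_i)\le\tau_i-\gamma$ for all $i\notin A$. $\mathrm{P}_\gamma\text{-}\mathrm{dim}$ is the maximum size of a dataset that can be $\gamma$-shattered. *)

theory Defs
  imports "HOL-Probability.Probability"
begin

(* Periods are numbered from 1. Demands are functions of the period, and an (s,S) policy is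
   the pair (s, S). *)

definition holding_backlog_cost :: "real \<Rightarrow> real \<Rightarrow> real \<Rightarrow> real" where
  "holding_backlog_cost h b x = h * max x 0 + b * max (- x) 0"

definition ss_policies :: "real \<Rightarrow> ereal \<Rightarrow> (real \<times> real) set" where
  "ss_policies Hlow H = {(s, S). Hlow \<le> s \<and> s \<le> S \<and> ereal S \<le> H \<and> 0 \<le> S}"

definition ss_order :: "real \<times> real \<Rightarrow> real \<Rightarrow> real" where
  "ss_order \<pi> I = (snd \<pi> - I) * of_bool (I \<le> fst \<pi>)"

(* inv_level L x1 p d t is x^t and order_qty L x1 p d t is q^t. Truncated subtraction
   sends every period t - L <= 0 to period 0, where the order is 0, as required for
   all non-positive periods; repeated non-positive periods in the pipeline sum contribute 0.
   The value of inv_level at period 0 is never used. *)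
function inv_level :: "nat \<Rightarrow> real \<Rightarrow> real \<times> real \<Rightarrow> (nat \<Rightarrow> real) \<Rightarrow> nat \<Rightarrow> real"
  and order_qty :: "nat \<Rightarrow> real \<Rightarrow> real \<times> real \<Rightarrow> (nat \<Rightarrow> real) \<Rightarrow> nat \<Rightarrow> real"
where
  "inv_level L x1 \<pi> d t =
     (if t \<le> 1 then x1
      else inv_level L x1 \<pi> d (t - 1) + order_qty L x1 \<pi> d (t - 1 - L) - d (t - 1))"
| "order_qty L x1 \<pi> d t =
     (if t = 0 then 0
      else ss_order \<pi> (inv_level L x1 \<pi> d t + (\<Sum>t'\<in>{t - L..<t}. order_qty L x1 \<pi> d t')))"
  by pat_completeness auto
termination
  by (relation "Wellfounded.measure (\<lambda>p. case p of Inl (L, x1, \<pi>, d, t) \<Rightarrow> 2 * t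
                                     | Inr (L, x1, \<pi>, d, t) \<Rightarrow> 2 * t + 1)") auto

declare inv_level.simps [simp del] order_qty.simps [simp del]

definition level_after :: "nat \<Rightarrow> real \<Rightarrow> real \<times> real \<Rightarrow> (nat \<Rightarrow> real) \<Rightarrow> nat \<Rightarrow> real" where
  "level_after L x1 \<pi> d t = inv_level L x1 \<pi> d t + order_qty L x1 \<pi> d (t - L)"

definition period_loss ::
  "real \<Rightarrow> real \<Rightarrow> real \<Rightarrow> nat \<Rightarrow> real \<Rightarrow> real \<times> real \<Rightarrow> (nat \<Rightarrow> real) \<Rightarrow> nat \<Rightarrow> real" where
  "period_loss h b K L x1 \<pi> d t =
     holding_backlog_cost h b (level_after L x1 \<pi> d t - d t)
     + K * of_bool (order_qty L x1 \<pi> d (t - L) > 0)"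

definition inv_loss ::
  "real \<Rightarrow> real \<Rightarrow> real \<Rightarrow> nat \<Rightarrow> nat \<Rightarrow> real \<Rightarrow> real \<times> real \<Rightarrow> (nat \<Rightarrow> real) \<Rightarrow> real" where
  "inv_loss h b K L T x1 \<pi> d = 1 / real T * (\<Sum>t = L + 1..T + L. period_loss h b K L x1 \<pi> d t)"

(* [0,U]^n with its Borel sigma-algebra; elements are extensional functions on {1..n}. *)
definition demand_space :: "real \<Rightarrow> nat \<Rightarrow> (nat \<Rightarrow> real) measure" where
  "demand_space U n = (\<Pi>\<^sub>M t\<in>{1..n}. restrict_space borel {0..U})"

definition risk :: "('p \<Rightarrow> 'd \<Rightarrow> real) \<Rightarrow> 'd measure \<Rightarrow> 'p \<Rightarrow> real" where
  "risk f D \<pi> = (LINT d|D. f \<pi> d)"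

definition emp_risk :: "('p \<Rightarrow> 'd \<Rightarrow> real) \<Rightarrow> nat \<Rightarrow> (nat \<Rightarrow> 'd) \<Rightarrow> 'p \<Rightarrow> real" where
  "emp_risk f N ds \<pi> = 1 / real N * (\<Sum>i = 1..N. f \<pi> (ds i))"

(* The real-valued supremum is meaningful for nonempty P and losses uniformly bounded below
   on the data with uniformly bounded risk; inv_loss with h = K = 0 has values in
   [0, b * (U * (L + 1) - Hlow)] for (s,S) policies with x1 <= Hlow <= 0. *)
definition gen_error ::
  "'p set \<Rightarrow> ('p \<Rightarrow> 'd \<Rightarrow> real) \<Rightarrow> 'd measure \<Rightarrow> nat \<Rightarrow> (nat \<Rightarrow> 'd) \<Rightarrow> real" where
  "gen_error P f D N ds = (SUP \<pi>\<in>P. risk f D \<pi> - emp_risk f N ds \<pi>)"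

(* A supremum over an uncountable class need not be Borel measurable, so the expectation over
   the i.i.d. sample is taken with respect to the completed product measure; for Borel
   measurable integrands this does not change the value (integral_completion). *)
definition expected_gen_error ::
  "'p set \<Rightarrow> ('p \<Rightarrow> 'd \<Rightarrow> real) \<Rightarrow> 'd measure \<Rightarrow> nat \<Rightarrow> real" where
  "expected_gen_error P f D N =
     (LINT ds|completion (\<Pi>\<^sub>M i\<in>{1..N}. D). gen_error P f D N ds)"

definition shattered ::
  "real \<Rightarrow> 'p set \<Rightarrow> ('p \<Rightarrow> 'd \<Rightarrow> real) \<Rightarrow> nat \<Rightarrow> (nat \<Rightarrow> 'd) \<Rightarrow> bool" where
  "shattered \<gamma> P f m ds \<longleftrightarrow>
     (\<exists>\<tau> :: nat \<Rightarrow> real. \<forall>A\<subseteq>{1..m}. \<exists>\<pi>\<in>P.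
        (\<forall>i\<in>A. f \<pi> (ds i) > \<tau> i + \<gamma>) \<and> (\<forall>i\<in>{1..m} - A. f \<pi> (ds i) \<le> \<tau> i - \<gamma>))"

(* The value is \<infinity> if arbitrarily large datasets in X can be shattered. *)
definition pseudo_dim :: "real \<Rightarrow> 'd set \<Rightarrow> 'p set \<Rightarrow> ('p \<Rightarrow> 'd \<Rightarrow> real) \<Rightarrow> enat" where
  "pseudo_dim \<gamma> X P f =
     Sup {enat m | m. \<exists>ds. (\<forall>i\<in>{1..m}. ds i \<in> X) \<and> shattered \<gamma> P f m ds}"

end

theory Submission
  imports Defs
begin

text \<open>
  It suffices to shatter \<open>m\<close> demand sequences, with \<open>m\<close> of order \<open>log T\<close>, and to let the
  distribution be uniform on them. A policy that has a large loss exactly on the sequences that are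
  under-represented in the sample then has generalization error at least \<open>\<gamma>\<close> times the
  \<open>L\<^sup>1\<close> distance between the empirical and the true distribution, up to a term with mean
  zero; by a fourth moment argument that distance is at least of order \<open>sqrt (m / N)\<close> on average once \<open>N \<ge> m\<close>.

  For the shattering, fix the reorder point \<open>s = - 1\<close> and choose \<open>S\<close> from \<open>2 ^ m\<close> levels
  \<open>S\<^sub>a\<close> in \<open>[0, 1/8)\<close>. During an initial phase the inventory position of level \<open>a\<close> alternates
  between the two states \<open>S\<^sub>a\<close> and \<open>S\<^sub>a - 1/2\<close>. Three demands, tuned to \<open>S\<^sub>j\<close>, swap the states of
  all levels \<open>a \<le> j\<close> and keep the other levels in the state \<open>S\<^sub>a - 1/2\<close>, in which every level
  starts; so arbitrary final states can be prescribed by going through \<open>j = 0, 1, \<dots>\<close>. After the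
  initial phase all demands vanish and the position is frozen, either at a non-negative value without loss or at a backlog of at least
  \<open>3/8\<close> in each remaining period. Whatever the lead time, the initial phase of \<open>n\<close> periods
  contributes at most \<open>b * n * (n + 1)\<close> to the total loss, which is negligible if \<open>n\<close> is a small
  multiple of \<open>sqrt T\<close>.
\<close>

subsection \<open>Absolute deviation of counts\<close>

text \<open>Coordinate \<open>i\<close> splits off as a factor \<open>J\<close>. This drives the
  induction for the moments below; a general \<open>F\<close> serves every power.\<close>

lemma sum_PiE_insert:
  fixes F :: "real \<Rightarrow> real"
  assumes "i \<notin> I" "finite I"
  shows "(\<Sum>p\<in>Pi\<^sub>E (insert i I) (\<lambda>_. J). F (\<Sum>k\<in>insert i I. g (p k))) =
    (\<Sum>x\<in>J. \<Sum>p\<in>Pi\<^sub>E I (\<lambda>_. J). F (g x + (\<Sum>k\<in>I. g (p k))))"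
proof -
  have "(\<Sum>p\<in>Pi\<^sub>E (insert i I) (\<lambda>_. J). F (\<Sum>k\<in>insert i I. g (p k))) =
    (\<Sum>(x, p)\<in>J \<times> Pi\<^sub>E I (\<lambda>_. J). F (\<Sum>k\<in>insert i I. g ((p(i := x)) k)))"
    unfolding PiE_insert_eq
    by (subst sum.reindex) (use inj_combinator[OF assms(1), of "\<lambda>_. J"] in \<open>auto simp: case_prod_unfold\<close>)
  also have "\<dots> = (\<Sum>(x, p)\<in>J \<times> Pi\<^sub>E I (\<lambda>_. J). F (g x + (\<Sum>k\<in>I. g (p k))))"
  proof (intro sum.cong refl, clarify)
    fix x p
    have "(\<Sum>k\<in>I. g ((p(i := x)) k)) = (\<Sum>k\<in>I. g (p k))"
      using assms by (intro sum.cong) auto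
    then show "F (\<Sum>k\<in>insert i I. g ((p(i := x)) k)) = F (g x + (\<Sum>k\<in>I. g (p k)))"
      using assms by simp
  qed
  finally show ?thesis by (simp add: sum.cartesian_product)
qed

text \<open>Divided by \<open>c ^ card I\<close>, these are moments of a sum of independent uniform
  draws from \<open>J\<close>, each transformed by a centred \<open>g\<close> with moments
  \<open>A2\<close> and \<open>A4\<close>. Cross terms with an isolated factor vanish, which leaves
  the diagonal and, in the fourth moment, the paired terms. The identities are proved together
  because the step for the fourth moment uses the first two.\<close>

lemma PiE_sum_moments:
  fixes g :: "'a \<Rightarrow> real"
  assumes J: "finite J" "J \<noteq> {}" and centred: "(\<Sum>x\<in>J. g x) = 0" and "finite I"
  defines "c \<equiv> real (card J)"
  defines "A2 \<equiv> (\<Sum>x\<in>J. g x ^ 2) / c" and "A4 \<equiv> (\<Sum>x\<in>J. g x ^ 4) / c"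
  shows "(\<Sum>p\<in>Pi\<^sub>E I (\<lambda>_. J). \<Sum>k\<in>I. g (p k)) = 0"
    and "(\<Sum>p\<in>Pi\<^sub>E I (\<lambda>_. J). (\<Sum>k\<in>I. g (p k)) ^ 2) = c ^ card I * (real (card I) * A2)"
    and "(\<Sum>p\<in>Pi\<^sub>E I (\<lambda>_. J). (\<Sum>k\<in>I. g (p k)) ^ 4) =
      c ^ card I * (real (card I) * A4 + 3 * real (card I) * (real (card I) - 1) * A2 ^ 2)"
proof -
  have c: "c > 0" using J by (simp add: c_def card_gt_0_iff)
  have g2: "(\<Sum>x\<in>J. g x ^ 2) = c * A2" and g4: "(\<Sum>x\<in>J. g x ^ 4) = c * A4"
    using c by (simp_all add: A2_def A4_def)
  have card_PiE: "real (card (Pi\<^sub>E K (\<lambda>_. J))) = c ^ card K" if "finite K" for K :: "'b set"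
    using that by (simp add: card_PiE c_def)
  have "(\<Sum>p\<in>Pi\<^sub>E I (\<lambda>_. J). \<Sum>k\<in>I. g (p k)) = 0 \<and>
    (\<Sum>p\<in>Pi\<^sub>E I (\<lambda>_. J). (\<Sum>k\<in>I. g (p k)) ^ 2) = c ^ card I * (real (card I) * A2) \<and>
    (\<Sum>p\<in>Pi\<^sub>E I (\<lambda>_. J). (\<Sum>k\<in>I. g (p k)) ^ 4) =
      c ^ card I * (real (card I) * A4 + 3 * real (card I) * (real (card I) - 1) * A2 ^ 2)"
    using \<open>finite I\<close>
  proof (induction I rule: finite_induct)
    case empty
    then show ?case by simp
  next
    case (insert i I)
    let ?P = "Pi\<^sub>E I (\<lambda>_. J)"
    define X where "X p = (\<Sum>k\<in>I. g (p k))" for p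
    have IH: "(\<Sum>p\<in>?P. X p) = 0" "(\<Sum>p\<in>?P. X p ^ 2) = c ^ card I * (real (card I) * A2)"
      "(\<Sum>p\<in>?P. X p ^ 4) =
        c ^ card I * (real (card I) * A4 + 3 * real (card I) * (real (card I) - 1) * A2 ^ 2)"
      using insert.IH by (simp_all add: X_def)
    note eq = sum_PiE_insert[OF insert.hyps(2,1), where J = J and g = g, folded X_def]
    have "(\<Sum>x\<in>J. \<Sum>p\<in>?P. g x + X p) = 0"
      by (simp add: sum.distrib IH flip: sum_distrib_left) (simp add: centred)
    moreover have "(\<Sum>x\<in>J. \<Sum>p\<in>?P. (g x + X p) ^ 2) =
      (\<Sum>x\<in>J. g x ^ 2 * c ^ card I + 2 * g x * (\<Sum>p\<in>?P. X p) + (\<Sum>p\<in>?P. X p ^ 2))"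
      by (intro sum.cong refl)
        (simp add: power2_sum sum.distrib card_PiE insert.hyps sum_distrib_left mult_ac)
    then have "(\<Sum>x\<in>J. \<Sum>p\<in>?P. (g x + X p) ^ 2) = c ^ Suc (card I) * ((real (card I) + 1) * A2)"
      by (simp add: IH sum.distrib g2 flip: sum_distrib_right c_def) (simp add: algebra_simps)
    \<comment> \<open>The term with \<open>X p ^ 3\<close> is kept as a multiple of
      \<open>g x\<close>: summed over \<open>x\<close> it vanishes, so the third moment of
      \<open>X\<close> need not be known.\<close>
    moreover have "(g x + X p) ^ 4 =
        g x ^ 4 + 4 * (g x ^ 3 * X p) + 6 * (g x ^ 2 * X p ^ 2) + g x * (4 * X p ^ 3) + X p ^ 4" for x p
      by algebra
    then have "(\<Sum>x\<in>J. \<Sum>p\<in>?P. (g x + X p) ^ 4) =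
      (\<Sum>x\<in>J. g x ^ 4 * c ^ card I + 4 * (g x ^ 3 * (\<Sum>p\<in>?P. X p)) + 6 * (g x ^ 2 * (\<Sum>p\<in>?P. X p ^ 2))
        + g x * (4 * (\<Sum>p\<in>?P. X p ^ 3)) + (\<Sum>p\<in>?P. X p ^ 4))"
      by (intro sum.cong refl)
        (simp add: sum.distrib card_PiE insert.hyps flip: sum_distrib_left)
    then have "(\<Sum>x\<in>J. \<Sum>p\<in>?P. (g x + X p) ^ 4) =
      c * A4 * c ^ card I + 6 * (c * A2) * (c ^ card I * (real (card I) * A2)) +
      c * (c ^ card I * (real (card I) * A4 + 3 * real (card I) * (real (card I) - 1) * A2 ^ 2))"
      by (simp add: IH sum.distrib g4 centred flip: sum_distrib_right sum_distrib_left c_def)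
        (simp add: g2 flip: sum_distrib_right sum_distrib_left)
    then have "(\<Sum>x\<in>J. \<Sum>p\<in>?P. (g x + X p) ^ 4) =
      c ^ Suc (card I) * ((real (card I) + 1) * A4 + 3 * (real (card I) + 1) * real (card I) * A2 ^ 2)"
      by (simp add: algebra_simps power2_eq_square)
    ultimately show ?case
      using insert.hyps eq[of "\<lambda>y. y"] eq[of "\<lambda>y. y ^ 2"] eq[of "\<lambda>y. y ^ 4"]
      by (simp add: add.commute)
  qed
  then show "(\<Sum>p\<in>Pi\<^sub>E I (\<lambda>_. J). \<Sum>k\<in>I. g (p k)) = 0"
    and "(\<Sum>p\<in>Pi\<^sub>E I (\<lambda>_. J). (\<Sum>k\<in>I. g (p k)) ^ 2) = c ^ card I * (real (card I) * A2)"
    and "(\<Sum>p\<in>Pi\<^sub>E I (\<lambda>_. J). (\<Sum>k\<in>I. g (p k)) ^ 4) =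
      c ^ card I * (real (card I) * A4 + 3 * real (card I) * (real (card I) - 1) * A2 ^ 2)"
    by blast+
qed

text \<open>An even quartic below the absolute value, tangent to it at \<open>a\<close> and
  \<open>- a\<close>. It bounds a first absolute moment from below by the second and fourth
  moments.\<close>

lemma abs_ge_moments:
  fixes x a :: real
  assumes "a > 0"
  shows "\<bar>x\<bar> \<ge> (3 * a\<^sup>2 * x\<^sup>2 - x ^ 4) / (2 * a ^ 3)"
proof -
  have "0 \<le> \<bar>x\<bar> * ((\<bar>x\<bar> - a)\<^sup>2 * (\<bar>x\<bar> + 2 * a))"
    using assms by simp
  also have "\<dots> = \<bar>x\<bar> ^ 4 - 3 * a\<^sup>2 * \<bar>x\<bar>\<^sup>2 + 2 * a ^ 3 * \<bar>x\<bar>"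
    by algebra
  finally show ?thesis
    using assms by (simp add: field_simps)
qed

text \<open>The number of draws equal to \<open>x\<close> has variance \<open>v\<close>, at least N
  / (2 m), and fourth central moment at most 5 v^2. The quartic minorant then gives a mean absolute
  deviation of at least sqrt (v / 5).\<close>

lemma PiE_centred_count_abs:
  fixes J :: "'a set" and I :: "'b set"
  assumes J: "finite J" and m: "card J \<ge> 2" and I: "finite I" "card J \<le> card I" and x: "x \<in> J"
  defines "m \<equiv> real (card J)" and "N \<equiv> real (card I)"
  shows "(\<Sum>p\<in>Pi\<^sub>E I (\<lambda>_. J). \<bar>\<Sum>k\<in>I. of_bool (p k = x) - 1 / m\<bar>) / m ^ card I \<ge> sqrt (N / (10 * m))"
proof -
  define g where "g y = of_bool (y = x) - 1 / m" for y
  define X where "X p = (\<Sum>k\<in>I. g (p k))" for p :: "'b \<Rightarrow> 'a"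
  define A2 where "A2 = (\<Sum>x\<in>J. g x ^ 2) / m"
  define A4 where "A4 = (\<Sum>x\<in>J. g x ^ 4) / m"
  have m2: "m \<ge> 2" "N \<ge> m" using m I by (auto simp: m_def N_def)
  have J_split: "(\<Sum>y\<in>J. F (g y)) = F (1 - 1 / m) + (m - 1) * F (- 1 / m)" for F :: "real \<Rightarrow> real"
  proof -
    have "(\<Sum>y\<in>J. F (g y)) = F (g x) + (\<Sum>y\<in>J - {x}. F (g y))"
      using x J by (simp add: sum.remove)
    also have "(\<Sum>y\<in>J - {x}. F (g y)) = (\<Sum>y\<in>J - {x}. F (- 1 / m))"
      by (intro sum.cong) (auto simp: g_def)
    also have "\<dots> = (m - 1) * F (- 1 / m)"
      using x J m by (simp add: m_def of_nat_diff)
    finally show ?thesis by (simp add: g_def)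
  qed
  have sum0: "(\<Sum>y\<in>J. g y) = 0"
    using J_split[of "\<lambda>y. y"] m2 by (simp add: field_simps)
  have A2: "A2 = (1 - 1 / m) / m"
    unfolding A2_def J_split[of "\<lambda>y. y ^ 2"] using m2
    by (simp add: field_simps power2_eq_square)
  have "g y ^ 4 \<le> g y ^ 2" for y
  proof -
    have "\<bar>g y\<bar> \<le> 1" using m2 by (auto simp: g_def field_simps)
    then have "(g y)\<^sup>2 \<le> 1" by (simp add: abs_square_le_1)
    then have "(g y)\<^sup>2 * (g y)\<^sup>2 \<le> (g y)\<^sup>2 * 1" by (intro mult_left_mono) auto
    then show ?thesis by (simp flip: power_add)
  qed
  then have A4: "A4 \<le> A2"
    using m2 unfolding A2_def A4_def by (intro divide_right_mono sum_mono) auto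
  define v where "v = N * A2"
  have "A2 \<ge> 1 / (2 * m)"
    using m2 unfolding A2 by (simp add: field_simps)
  then have v: "v \<ge> N / (2 * m)"
    using m2 mult_left_mono[of "1 / (2 * m)" A2 N] by (simp add: v_def)
  moreover have "N / (2 * m) \<ge> 1 / 2" using m2 by (simp add: field_simps)
  ultimately have v2: "v \<ge> 1 / 2" by linarith
  note mom = PiE_sum_moments[OF J _ sum0 I(1), folded m_def, folded N_def, folded A2_def A4_def, folded X_def]
  have "J \<noteq> {}" using x by blast
  note mom = mom[OF this]
  \<comment> \<open>This choice maximizes (3 a^2 v - 5 v^2) / (2 a^3); the maximum is a / 5.\<close>
  define a where "a = sqrt (5 * v)"
  have a: "a > 0" "a\<^sup>2 = 5 * v" using v2 by (auto simp: a_def)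
  have "N * A4 + 3 * N * (N - 1) * A2\<^sup>2 \<le> v + 3 * v\<^sup>2"
  proof -
    have "N * A4 \<le> v" using A4 m2 by (simp add: v_def mult_left_mono)
    moreover have "3 * N * (N - 1) * A2\<^sup>2 \<le> 3 * v\<^sup>2"
    proof -
      have "3 * N * (N - 1) * A2\<^sup>2 \<le> 3 * N * N * A2\<^sup>2"
        using m2 by (intro mult_right_mono mult_left_mono) auto
      then show ?thesis by (simp add: v_def power2_eq_square mult_ac)
    qed
    ultimately show ?thesis by linarith
  qed
  \<comment> \<open>Uses \<open>v \<ge> 1 / 2\<close>, which rests on having at least as many draws
    as points.\<close>
  also have "\<dots> \<le> 5 * v\<^sup>2"
    using v2 mult_right_mono[of "1/2" v v] by (simp add: power2_eq_square)
  finally have fourth: "N * A4 + 3 * N * (N - 1) * A2\<^sup>2 \<le> 5 * v\<^sup>2" .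
  have "m ^ card I * (a / 5) = m ^ card I * ((3 * a\<^sup>2 * v - 5 * v\<^sup>2) / (2 * a ^ 3))"
  proof -
    have "a ^ 3 = a * (5 * v)" using a(2) by (simp add: power3_eq_cube power2_eq_square)
    then have "(3 * a\<^sup>2 * v - 5 * v\<^sup>2) / (2 * a ^ 3) = v / a"
      using a v2 by (simp add: field_simps power2_eq_square)
    also have "\<dots> = a / 5" using a v2 by (simp add: field_simps power2_eq_square)
    finally show ?thesis by (simp only:)
  qed
  also have "\<dots> \<le> m ^ card I * ((3 * a\<^sup>2 * v - (N * A4 + 3 * N * (N - 1) * A2\<^sup>2)) / (2 * a ^ 3))"
    using fourth a m2 by (intro mult_left_mono divide_right_mono) auto
  also have "\<dots> = (3 * a\<^sup>2 * (\<Sum>p\<in>Pi\<^sub>E I (\<lambda>_. J). X p ^ 2) - (\<Sum>p\<in>Pi\<^sub>E I (\<lambda>_. J). X p ^ 4)) / (2 * a ^ 3)"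
    unfolding mom v_def by (simp add: algebra_simps)
  also have "\<dots> = (\<Sum>p\<in>Pi\<^sub>E I (\<lambda>_. J). (3 * a\<^sup>2 * X p ^ 2 - X p ^ 4) / (2 * a ^ 3))"
    by (simp add: sum_subtractf sum_distrib_left flip: sum_divide_distrib)
  also have "\<dots> \<le> (\<Sum>p\<in>Pi\<^sub>E I (\<lambda>_. J). \<bar>X p\<bar>)"
    by (intro sum_mono abs_ge_moments a)
  finally have "a / 5 \<le> (\<Sum>p\<in>Pi\<^sub>E I (\<lambda>_. J). \<bar>X p\<bar>) / m ^ card I"
    using m2 by (simp add: field_simps)
  moreover have "sqrt (N / (10 * m)) \<le> a / 5"
  proof -
    have "sqrt (N / (10 * m)) \<le> sqrt (v / 5)"
      using v by (intro real_sqrt_le_mono) (simp add: field_simps)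
    also have "\<dots> = a / 5"
      using v2 by (intro real_sqrt_unique) (auto simp: a power_divide a_def)
    finally show ?thesis .
  qed
  ultimately show ?thesis unfolding X_def g_def by linarith
qed

subsection \<open>Distributions on finitely many points\<close>

lemma sets_PiM_singleton:
  assumes "finite I" "x \<in> space (PiM I M)" "\<And>i. i \<in> I \<Longrightarrow> {x i} \<in> sets (M i)"
  shows "{x} \<in> sets (PiM I M)"
proof -
  have "x \<in> extensional I"
    using assms(2) by (simp add: space_PiM PiE_def)
  then have "{x} = Pi\<^sub>E I (\<lambda>i. {x i})"
    by (simp add: PiE_singleton)
  also have "\<dots> \<in> sets (PiM I M)"
    using assms by (intro sets_PiM_I_finite) auto
  finally show ?thesis .
qed

lemma integral_finite_support:
  fixes g :: "'a \<Rightarrow> real"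
  assumes F: "finite F" "\<And>x. x \<in> F \<Longrightarrow> {x} \<in> sets M" "AE x in M. x \<in> F"
    and "finite_measure M" and g: "g \<in> borel_measurable M"
  shows "(LINT x|M. g x) = (\<Sum>x\<in>F. measure M {x} * g x)"
proof -
  interpret finite_measure M by fact
  have F_sub: "x \<in> space M" if "x \<in> F" for x
    using F(2)[OF that] sets.sets_into_space by blast
  have "(LINT x|M. g x) = (LINT x|M. (\<Sum>y\<in>F. g y * indicator {y} x))"
  proof (rule integral_cong_AE)
    show "(\<lambda>x. \<Sum>y\<in>F. g y * indicator {y} x) \<in> borel_measurable M"
      using F(2) by (intro borel_measurable_sum borel_measurable_times borel_measurable_indicator) auto
    show "AE x in M. g x = (\<Sum>y\<in>F. g y * indicator {y} x)"
      using F(3)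
    proof eventually_elim
      case (elim x)
      have "(\<Sum>y\<in>F. g y * indicator {y} x) = (\<Sum>y\<in>F. if x = y then g y else 0)"
        by (intro sum.cong) auto
      then show ?case using elim F(1) by simp
    qed
  qed fact
  also have "\<dots> = (\<Sum>y\<in>F. LINT x|M. g y * indicator {y} x)"
    using F by (intro Bochner_Integration.integral_sum integrable_mult_right integrable_real_indicator)
      (auto simp: emeasure_eq_measure)
  also have "\<dots> = (\<Sum>y\<in>F. measure M {y} * g y)"
  proof (intro sum.cong refl)
    fix y assume "y \<in> F"
    then have "{y} \<inter> space M = {y}" using F_sub by auto
    then show "(LINT x|M. g y * indicator {y} x) = measure M {y} * g y"
      by simp
  qed
  finally show ?thesis .
qed

text \<open>A preimage splits into a subset of the finite set \<open>F\<close> and a null set, so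
  every real function is measurable for the completion. This covers the supremum in
  \<open>gen_error\<close>.\<close>

lemma borel_measurable_completion_finite_support:
  fixes g :: "'a \<Rightarrow> real"
  assumes "finite F" "\<And>x. x \<in> F \<Longrightarrow> {x} \<in> sets M" "AE x in M. x \<in> F"
  shows "g \<in> borel_measurable (completion M)"
proof -
  have "Measurable.pred (completion M) (\<lambda>x. g x \<in> A)" for A
  proof -
    have "F \<inter> {x. g x \<in> A} = (\<Union>x\<in>F \<inter> {x. g x \<in> A}. {x})"
      by auto
    then have "F \<inter> {x. g x \<in> A} \<in> sets M"
      using assms(1,2) by (metis (lifting) IntE finite_Int sets.finite_UN)
    then have "Measurable.pred (completion M) (\<lambda>x. x \<in> F \<inter> {x. g x \<in> A})"
      by (intro pred_sets2[OF _ measurable_ident_sets]) auto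
    moreover have "AE x in M. \<not> (x \<notin> F \<and> g x \<in> A)"
      using assms(3) by eventually_elim auto
    then have "Measurable.pred (completion M) (\<lambda>x. x \<notin> F \<and> g x \<in> A)"
      by (rule sets_completion_AE)
    ultimately have "Measurable.pred (completion M)
        (\<lambda>x. x \<in> F \<inter> {x. g x \<in> A} \<or> (x \<notin> F \<and> g x \<in> A))"
      by (rule pred_intros_logic)
    then show ?thesis by (rule back_subst[of "Measurable.pred (completion M)"]) auto
  qed
  then show ?thesis
    by (intro measurableI) (auto simp: pred_def vimage_def Int_def conj_commute)
qed

text \<open>The pushforward replaces the power set of \<open>J\<close> by the sigma-algebra of
  \<open>X\<close>, as a distribution on the demand space requires.\<close>

definition uniform_on :: "'d measure \<Rightarrow> 'd set \<Rightarrow> 'd measure" where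
  "uniform_on X J = distr (uniform_count_measure J) X (\<lambda>x. x)"

context
  fixes X :: "'d measure" and J :: "'d set"
  assumes J: "finite J" "J \<noteq> {}" "J \<subseteq> space X" "\<And>x. x \<in> J \<Longrightarrow> {x} \<in> sets X"
begin

lemma id_measurable_uniform_count: "(\<lambda>x. x) \<in> measurable (uniform_count_measure J) X"
  using J(3) by (auto simp: measurable_def space_uniform_count_measure sets_uniform_count_measure)

lemma sets_uniform_on: "sets (uniform_on X J) = sets X"
  by (simp add: uniform_on_def)

lemma prob_space_uniform_on: "prob_space (uniform_on X J)"
  unfolding uniform_on_def
  by (intro prob_space.prob_space_distr prob_space_uniform_count_measure id_measurable_uniform_count J)

lemma measure_uniform_on_singleton:
  assumes "x \<in> J"
  shows "measure (uniform_on X J) {x} = 1 / card J"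
proof -
  have "(\<lambda>x. x) -` {x} \<inter> space (uniform_count_measure J) = {x}"
    using assms by (auto simp: space_uniform_count_measure)
  then show ?thesis
    unfolding uniform_on_def using assms J
    by (subst measure_distr) (auto simp: id_measurable_uniform_count measure_uniform_count_measure)
qed

lemma AE_uniform_on: "AE x in uniform_on X J. x \<in> J"
proof -
  have "J = (\<Union>x\<in>J. {x})" by auto
  also have "\<dots> \<in> sets X" using J by (intro sets.finite_UN) auto
  finally have "J \<in> sets X" .
  then have "{x \<in> space X. x \<in> J} \<in> sets X" by (simp add: Collect_conj_eq Int_def[symmetric])
  then show ?thesis
    unfolding uniform_on_def
    by (subst AE_distr_iff[OF id_measurable_uniform_count])
      (use AE_space[of "uniform_count_measure J"] in \<open>simp_all add: space_uniform_count_measure\<close>)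
qed

lemma integral_uniform_on:
  fixes f :: "'d \<Rightarrow> real"
  assumes "f \<in> borel_measurable X"
  shows "(LINT x|uniform_on X J. f x) = (\<Sum>x\<in>J. f x) / card J"
proof -
  interpret prob_space "uniform_on X J" by (rule prob_space_uniform_on)
  have "(LINT x|uniform_on X J. f x) = (\<Sum>x\<in>J. measure (uniform_on X J) {x} * f x)"
    using J AE_uniform_on assms
    by (intro integral_finite_support)
      (auto simp: sets_uniform_on finite_measure_axioms cong: measurable_cong_sets)
  then show ?thesis
    by (simp add: measure_uniform_on_singleton sum_divide_distrib)
qed

text \<open>The product is concentrated on finitely many, equally likely samples, so an expectation
  is an average over them for arbitrary \<open>g\<close>.\<close>

lemma integral_completion_PiM_uniform_on:
  fixes g :: "('i \<Rightarrow> 'd) \<Rightarrow> real"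
  assumes I: "finite I"
  shows "(LINT p|completion (\<Pi>\<^sub>M i\<in>I. uniform_on X J). g p) =
    (\<Sum>p\<in>Pi\<^sub>E I (\<lambda>_. J). g p) / card J ^ card I"
proof -
  interpret D: prob_space "uniform_on X J" by (rule prob_space_uniform_on)
  interpret finite_product_prob_space "\<lambda>_. uniform_on X J" I
    by unfold_locales (rule I)
  let ?M = "\<Pi>\<^sub>M i\<in>I. uniform_on X J"
  have sp: "space (uniform_on X J) = space X"
    by (simp add: uniform_on_def)
  have sing: "{p} \<in> sets ?M" if "p \<in> Pi\<^sub>E I (\<lambda>_. J)" for p
    using that J by (intro sets_PiM_singleton I) (auto simp: space_PiM sp sets_uniform_on)
  have "AE p in ?M. \<forall>i\<in>I. p i \<in> J"
    using I D.prob_space_axioms AE_uniform_on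
    by (intro AE_finite_allI AE_PiM_component) auto
  then have AE: "AE p in ?M. p \<in> Pi\<^sub>E I (\<lambda>_. J)"
    using AE_space[of ?M] by eventually_elim (auto simp: space_PiM PiE_iff)
  have meas: "measure ?M {p} = 1 / real (card J) ^ card I" if p: "p \<in> Pi\<^sub>E I (\<lambda>_. J)" for p
  proof -
    have "{p} = Pi\<^sub>E I (\<lambda>i. {p i})"
      using p PiE_singleton[of p I] by (simp add: PiE_iff)
    moreover have "{p i} \<in> sets (uniform_on X J)" if "i \<in> I" for i
      using J(4)[OF PiE_mem[OF p that]] by (simp add: sets_uniform_on)
    ultimately have "measure ?M {p} = (\<Prod>i\<in>I. measure (uniform_on X J) {p i})"
      by (simp only: finite_measure_PiM_emb)
    also have "\<dots> = (\<Prod>i\<in>I. 1 / real (card J))"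
      using p by (intro prod.cong measure_uniform_on_singleton) auto
    finally show ?thesis by (simp add: power_one_over)
  qed
  have "finite_measure (completion ?M)"
    by (intro finite_measureI) (simp add: P.emeasure_space_1)
  then have "(LINT p|completion ?M. g p) = (\<Sum>p\<in>Pi\<^sub>E I (\<lambda>_. J). measure (completion ?M) {p} * g p)"
    using sing AE I J(1)
    by (intro integral_finite_support borel_measurable_completion_finite_support)
      (auto intro: finite_PiE AE_completion)
  also have "\<dots> = (\<Sum>p\<in>Pi\<^sub>E I (\<lambda>_. J). g p) / card J ^ card I"
    by (simp add: sing meas sum_divide_distrib)
  finally show ?thesis .
qed

text \<open>On a sample in which the point \<open>x\<close> occurs \<open>n x\<close> times, the policy that selects the
  under-represented points has generalization error at least
  \<open>\<gamma> * (\<Sum>x. \<bar>n x / N - 1 / m\<bar>)\<close>, up to a term depending on \<open>\<tau>\<close> that is linear in \<open>n\<close> and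
  averages to zero.\<close>

lemma expected_gen_error_ge:
  fixes f :: "'p \<Rightarrow> 'd \<Rightarrow> real"
  assumes meas: "\<And>\<pi>. \<pi> \<in> P \<Longrightarrow> f \<pi> \<in> borel_measurable X"
    and bound: "\<And>\<pi> x. \<pi> \<in> P \<Longrightarrow> x \<in> J \<Longrightarrow> \<bar>f \<pi> x\<bar> \<le> B"
    and shatter: "\<And>A. A \<subseteq> J \<Longrightarrow> \<exists>\<pi>\<in>P. (\<forall>x\<in>A. f \<pi> x \<ge> \<tau> x + \<gamma>) \<and> (\<forall>x\<in>J - A. f \<pi> x \<le> \<tau> x - \<gamma>)"
    and "\<gamma> \<ge> 0" and m2: "card J \<ge> 2" and N: "card J \<le> N"
  shows "expected_gen_error P f (uniform_on X J) N \<ge> \<gamma> * sqrt (card J / (10 * real N))"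
proof -
  define m where "m = real (card J)"
  define Y where "Y x p = (\<Sum>k\<in>{1..N}. of_bool (p k = x) - 1 / m)" for x and p :: "nat \<Rightarrow> 'd"
  let ?D = "uniform_on X J"
  let ?S = "Pi\<^sub>E {1..N} (\<lambda>_. J)"
  have m: "m \<ge> 2" "real N \<ge> m" using m2 N by (auto simp: m_def)
  \<comment> \<open>The sample enters the difference of risks only through the centred counts
    \<open>Y x p\<close>, and linearly.\<close>
  have diff: "risk f ?D \<pi> - emp_risk f N p \<pi> = - (\<Sum>x\<in>J. Y x p * f \<pi> x) / N"
    if "\<pi> \<in> P" "p \<in> ?S" for \<pi> p
  proof -
    have "(\<Sum>x\<in>J. Y x p * f \<pi> x) =
        (\<Sum>k\<in>{1..N}. \<Sum>x\<in>J. of_bool (p k = x) * f \<pi> x) - (\<Sum>k\<in>{1..N}. \<Sum>x\<in>J. f \<pi> x / m)"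
      unfolding Y_def sum_distrib_right
      by (subst sum.swap) (simp add: left_diff_distrib sum_subtractf)
    also have "(\<Sum>k\<in>{1..N}. \<Sum>x\<in>J. of_bool (p k = x) * f \<pi> x) = (\<Sum>k\<in>{1..N}. f \<pi> (p k))"
    proof (intro sum.cong refl)
      fix k assume "k \<in> {1..N}"
      then have "p k \<in> J" using that by auto
      have "(\<Sum>x\<in>J. of_bool (p k = x) * f \<pi> x) = (\<Sum>x\<in>J. if p k = x then f \<pi> x else 0)"
        by (intro sum.cong) auto
      then show "(\<Sum>x\<in>J. of_bool (p k = x) * f \<pi> x) = f \<pi> (p k)"
        using \<open>p k \<in> J\<close> J(1) by simp
    qed
    finally have "(\<Sum>x\<in>J. Y x p * f \<pi> x) = (\<Sum>k\<in>{1..N}. f \<pi> (p k)) - N * ((\<Sum>x\<in>J. f \<pi> x) / m)"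
      by (simp add: sum_divide_distrib)
    then show ?thesis
      using meas[OF that(1)] m
      by (simp add: risk_def emp_risk_def integral_uniform_on m_def diff_divide_distrib)
  qed
  have gen: "gen_error P f ?D N p \<ge> (\<Sum>x\<in>J. \<gamma> * \<bar>Y x p\<bar> - \<tau> x * Y x p) / N" if p: "p \<in> ?S" for p
  proof -
    define A where "A = {x \<in> J. Y x p \<le> 0}"
    obtain \<pi> where \<pi>: "\<pi> \<in> P" "\<And>x. x \<in> A \<Longrightarrow> f \<pi> x \<ge> \<tau> x + \<gamma>" "\<And>x. x \<in> J - A \<Longrightarrow> f \<pi> x \<le> \<tau> x - \<gamma>"
      using shatter[of A] by (auto simp: A_def)
    have "\<gamma> * \<bar>Y x p\<bar> - \<tau> x * Y x p \<le> - (Y x p * f \<pi> x)" if "x \<in> J" for x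
    proof (cases "x \<in> A")
      case True
      then have "Y x p \<le> 0" by (simp add: A_def)
      with \<pi>(2)[OF True] have "- Y x p * (\<tau> x + \<gamma>) \<le> - Y x p * f \<pi> x"
        by (intro mult_left_mono) auto
      with \<open>Y x p \<le> 0\<close> show ?thesis by (simp add: algebra_simps)
    next
      case False
      then have "Y x p > 0" using that by (simp add: A_def)
      moreover have "Y x p * f \<pi> x \<le> Y x p * (\<tau> x - \<gamma>)"
        using \<pi>(3)[of x] False that \<open>Y x p > 0\<close> by (intro mult_left_mono) auto
      ultimately show ?thesis by (simp add: algebra_simps)
    qed
    then have "(\<Sum>x\<in>J. \<gamma> * \<bar>Y x p\<bar> - \<tau> x * Y x p) \<le> (\<Sum>x\<in>J. - (Y x p * f \<pi> x))"
      by (intro sum_mono)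
    from divide_right_mono[OF this, of "real N"]
    have "(\<Sum>x\<in>J. \<gamma> * \<bar>Y x p\<bar> - \<tau> x * Y x p) / N \<le> risk f ?D \<pi> - emp_risk f N p \<pi>"
      unfolding diff[OF \<pi>(1) p] by (simp add: sum_negf)
    also have "\<dots> \<le> gen_error P f ?D N p"
      unfolding gen_error_def
    proof (rule cSUP_upper[OF \<pi>(1)])
      \<comment> \<open>A real supremum dominates its members only if they are bounded above; this
        is where \<open>bound\<close> enters.\<close>
      show "bdd_above ((\<lambda>\<pi>. risk f ?D \<pi> - emp_risk f N p \<pi>) ` P)"
      proof (rule bdd_aboveI2)
        fix \<pi>' assume "\<pi>' \<in> P"
        have "- (\<Sum>x\<in>J. Y x p * f \<pi>' x) \<le> (\<Sum>x\<in>J. \<bar>Y x p\<bar> * B)"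
          unfolding sum_negf[symmetric]
        proof (rule sum_mono)
          fix x assume "x \<in> J"
          have "- (Y x p * f \<pi>' x) \<le> \<bar>Y x p\<bar> * \<bar>f \<pi>' x\<bar>"
            by (metis abs_ge_minus_self abs_mult)
          also have "\<dots> \<le> \<bar>Y x p\<bar> * B"
            using bound[OF \<open>\<pi>' \<in> P\<close> \<open>x \<in> J\<close>] by (intro mult_left_mono) auto
          finally show "- (Y x p * f \<pi>' x) \<le> \<bar>Y x p\<bar> * B" .
        qed
        then show "risk f ?D \<pi>' - emp_risk f N p \<pi>' \<le> (\<Sum>x\<in>J. \<bar>Y x p\<bar> * B) / N"
          unfolding diff[OF \<open>\<pi>' \<in> P\<close> p] by (intro divide_right_mono) auto
      qed
    qed
    finally show ?thesis .
  qed
  have centred: "(\<Sum>p\<in>?S. Y x p) = 0" if "x \<in> J" for x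
    unfolding Y_def
  proof (rule PiE_sum_moments(1)[OF J(1,2)])
    show "(\<Sum>y\<in>J. of_bool (y = x) - 1 / m) = 0"
      using that J m by (simp add: sum_subtractf m_def of_bool_def)
  qed simp
  have spread: "m ^ N * sqrt (N / (10 * m)) \<le> (\<Sum>p\<in>?S. \<bar>Y x p\<bar>)" if "x \<in> J" for x
    using PiE_centred_count_abs[of J "{1..N}" x] that J(1) m2 N m
    by (simp add: Y_def m_def field_simps)
  \<comment> \<open>Each of the m points has mean deviation at least sqrt (N / (10 m)); summing over
    the points and dividing by N yields the rate.\<close>
  have "\<gamma> * sqrt (m / (10 * N)) = (m * (\<gamma> * sqrt (N / (10 * m)))) / N"
  proof -
    have "sqrt (m / (10 * N)) = sqrt ((m / N)\<^sup>2 * (N / (10 * m)))"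
      using m by (simp add: power2_eq_square)
    also have "\<dots> = m / N * sqrt (N / (10 * m))"
      using m by (simp add: real_sqrt_mult del: times_divide_eq_right)
    finally show ?thesis by simp
  qed
  also have "\<dots> = (\<Sum>x\<in>J. \<gamma> * (m ^ N * sqrt (N / (10 * m)))) / N / m ^ N"
    using m by (simp add: m_def)
  also have "\<dots> \<le> (\<Sum>x\<in>J. \<gamma> * (\<Sum>p\<in>?S. \<bar>Y x p\<bar>)) / N / m ^ N"
    using spread \<open>\<gamma> \<ge> 0\<close> m by (intro divide_right_mono sum_mono mult_left_mono) auto
  \<comment> \<open>The thresholds \<open>\<tau> x\<close> can be inserted because the centred
    counts average to zero.\<close>
  also have "\<dots> = (\<Sum>x\<in>J. \<gamma> * (\<Sum>p\<in>?S. \<bar>Y x p\<bar>) - \<tau> x * (\<Sum>p\<in>?S. Y x p)) / N / m ^ N"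
    by (simp add: centred cong: sum.cong del: One_nat_def)
  also have "\<dots> = (\<Sum>p\<in>?S. (\<Sum>x\<in>J. \<gamma> * \<bar>Y x p\<bar> - \<tau> x * Y x p) / N) / m ^ N"
    by (subst sum_divide_distrib[symmetric], subst sum.swap)
      (simp add: sum_distrib_left sum_subtractf)
  also have "\<dots> \<le> (\<Sum>p\<in>?S. gen_error P f ?D N p) / m ^ N"
    using gen m by (intro divide_right_mono sum_mono) auto
  also have "\<dots> = expected_gen_error P f ?D N"
    by (simp add: expected_gen_error_def integral_completion_PiM_uniform_on m_def)
  finally show ?thesis by (simp add: m_def)
qed

end

subsection \<open>The inventory position\<close>

text \<open>The inventory position after ordering in period \<open>t + 1\<close>.\<close>

fun ss_position :: "real \<times> real \<Rightarrow> (nat \<Rightarrow> real) \<Rightarrow> nat \<Rightarrow> real" where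
  "ss_position \<pi> d 0 = snd \<pi>"
| "ss_position \<pi> d (Suc t) =
     (let I = ss_position \<pi> d t - d (Suc t) in if I \<le> fst \<pi> then snd \<pi> else I)"

context
  fixes L :: nat and x1 :: real and \<pi> :: "real \<times> real" and d :: "nat \<Rightarrow> real"
begin

definition inv_position :: "nat \<Rightarrow> real" where
  "inv_position t = inv_level L x1 \<pi> d t + (\<Sum>t'\<in>{t - L..<t}. order_qty L x1 \<pi> d t')"

lemma order_qty_0: "order_qty L x1 \<pi> d 0 = 0"
  by (simp add: order_qty.simps)

lemma order_qty_eq: "t \<ge> 1 \<Longrightarrow> order_qty L x1 \<pi> d t = ss_order \<pi> (inv_position t)"
  by (subst order_qty.simps) (simp add: inv_position_def)

lemma inv_position_1: "inv_position 1 = x1"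
proof -
  have "(\<Sum>t'\<in>{1 - L..<1}. order_qty L x1 \<pi> d t') = 0"
    by (intro sum.neutral) (auto simp: order_qty_0)
  then show ?thesis by (simp add: inv_position_def inv_level.simps)
qed

lemma inv_position_Suc:
  assumes "t \<ge> 1"
  shows "inv_position (Suc t) = inv_position t + order_qty L x1 \<pi> d t - d t"
proof -
  let ?q = "order_qty L x1 \<pi> d"
  have "sum ?q {Suc t - L..<Suc t} + ?q (t - L) = sum ?q {t - L..<t} + ?q t"
  \<comment> \<open>The pipeline window gains period \<open>t\<close> and loses period
    \<open>t - L\<close>. If t < L, truncated subtraction turns the lost period into 0, where the
    order is 0.\<close>
  proof (cases "L \<le> t")
    case True
    then have "{t - L..<Suc t} = insert (t - L) {Suc t - L..<Suc t}" by auto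
    moreover have "sum ?q {t - L..<Suc t} = sum ?q {t - L..<t} + ?q t"
      by simp
    ultimately show ?thesis using True by (simp add: Suc_diff_le)
  next
    case False
    then show ?thesis by (simp add: order_qty_0)
  qed
  moreover have "inv_level L x1 \<pi> d (Suc t) = inv_level L x1 \<pi> d t + ?q (t - L) - d t"
    using assms by (subst inv_level.simps) simp
  ultimately show ?thesis by (simp add: inv_position_def)
qed

lemma inv_position_add:
  assumes "t \<ge> 1"
  shows "inv_position (t + k) =
    inv_position t + (\<Sum>u\<in>{t..<t + k}. order_qty L x1 \<pi> d u) - (\<Sum>u\<in>{t..<t + k}. d u)"
  using assms by (induction k) (simp_all add: inv_position_Suc)

text \<open>As \<open>x1\<close> is at most the reorder point, the first period orders up to
  \<open>snd \<pi>\<close>; afterwards both sides obey the same recursion.\<close>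

lemma inv_position_order_qty:
  assumes "x1 \<le> fst \<pi>"
  shows "inv_position (Suc t) + order_qty L x1 \<pi> d (Suc t) = ss_position \<pi> d t"
proof (induction t)
  case 0
  then show ?case
    using assms inv_position_1 by (simp add: order_qty_eq ss_order_def)
next
  case (Suc t)
  have "inv_position (Suc (Suc t)) = ss_position \<pi> d t - d (Suc t)"
    using Suc.IH by (simp add: inv_position_Suc)
  then show ?case
    by (simp add: order_qty_eq ss_order_def Let_def)
qed

text \<open>In period t + 1 + L exactly the orders of the periods up to t + 1 have arrived, while
  the demands of periods t + 1 to t + L have left.\<close>

lemma level_after_eq:
  assumes "x1 \<le> fst \<pi>"
  shows "level_after L x1 \<pi> d (Suc t + L) = ss_position \<pi> d t - (\<Sum>u\<in>{Suc t..<Suc t + L}. d u)"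
  using inv_position_add[of "Suc t" L] inv_position_order_qty[OF assms, of t]
  by (simp add: level_after_def inv_position_def)

text \<open>Only backlog is charged; in period t + 1 + L it is the excess of the last L + 1 demands
  over the position after ordering in period t + 1.\<close>

lemma inv_loss_eq:
  assumes "x1 \<le> fst \<pi>"
  shows "inv_loss 0 b 0 L T x1 \<pi> d =
    b / real T * (\<Sum>t<T. max 0 ((\<Sum>u\<in>{Suc t..Suc t + L}. d u) - ss_position \<pi> d t))"
proof -
  have "(\<Sum>t = L + 1..T + L. period_loss 0 b 0 L x1 \<pi> d t) =
    (\<Sum>t<T. period_loss 0 b 0 L x1 \<pi> d (Suc t + L))"
    by (rule sum.reindex_bij_witness[of _ "\<lambda>t. Suc t + L" "\<lambda>t. t - Suc L"]) auto
  also have "\<dots> = (\<Sum>t<T. b * max 0 ((\<Sum>u\<in>{Suc t..Suc t + L}. d u) - ss_position \<pi> d t))"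
  proof (intro sum.cong refl)
    fix t
    have "(\<Sum>u\<in>{Suc t..Suc t + L}. d u) = (\<Sum>u\<in>{Suc t..<Suc t + L}. d u) + d (Suc t + L)"
      by (subst sum.last_plus) (auto simp: add.commute)
    then show "period_loss 0 b 0 L x1 \<pi> d (Suc t + L) =
        b * max 0 ((\<Sum>u\<in>{Suc t..Suc t + L}. d u) - ss_position \<pi> d t)"
      unfolding period_loss_def holding_backlog_cost_def level_after_eq[OF assms]
      by (simp add: max.commute algebra_simps)
  qed
  finally show ?thesis
    by (simp add: inv_loss_def sum_distrib_left)
qed

end

lemma ss_position_ge:
  assumes "fst \<pi> \<le> snd \<pi>"
  shows "fst \<pi> \<le> ss_position \<pi> d t"
  using assms by (cases t) (auto simp: Let_def)

text \<open>The strict inequality matters: a position equal to the reorder point triggers an order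
  even without demand.\<close>

lemma ss_position_idle:
  assumes "\<And>u. t < u \<Longrightarrow> u \<le> t + k \<Longrightarrow> d u = 0" "fst \<pi> < ss_position \<pi> d t"
  shows "ss_position \<pi> d (t + k) = ss_position \<pi> d t"
  using assms by (induction k) (auto simp: Let_def)

lemma ss_position_cong:
  assumes "\<And>u. 1 \<le> u \<Longrightarrow> u \<le> t \<Longrightarrow> d u = d' u"
  shows "ss_position \<pi> d t = ss_position \<pi> d' t"
  using assms by (induction t) (auto simp: Let_def)

text \<open>Demand over L + 1 periods is at most L + 1, and positions stay above \<open>Hlow\<close>
  or equal to it. The bound keeps the supremum in \<open>gen_error\<close> finite.\<close>

lemma inv_loss_bounds:
  assumes "x1 \<le> fst \<pi>" "Hlow \<le> fst \<pi>" "fst \<pi> \<le> snd \<pi>" "Hlow \<le> 0" "0 \<le> b"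
    and d: "\<And>t. 1 \<le> t \<Longrightarrow> t \<le> T + L \<Longrightarrow> d t \<in> {0..1}"
  shows "0 \<le> inv_loss 0 b 0 L T x1 \<pi> d" "inv_loss 0 b 0 L T x1 \<pi> d \<le> b * (real L + 1 - Hlow)"
proof -
  show "0 \<le> inv_loss 0 b 0 L T x1 \<pi> d"
    unfolding inv_loss_eq[OF assms(1)]
    using assms by (intro mult_nonneg_nonneg sum_nonneg) auto
  have "(\<Sum>t<T. max 0 ((\<Sum>u\<in>{Suc t..Suc t + L}. d u) - ss_position \<pi> d t)) \<le> (\<Sum>t<T. real L + 1 - Hlow)"
  proof (intro sum_mono max.boundedI)
    fix t assume t: "t \<in> {..<T}"
    show "0 \<le> real L + 1 - Hlow" using assms by simp
    have "(\<Sum>u\<in>{Suc t..Suc t + L}. d u) \<le> (\<Sum>u\<in>{Suc t..Suc t + L}. 1)"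
      using d t by (intro sum_mono) auto
    moreover have "fst \<pi> \<le> ss_position \<pi> d t"
      by (rule ss_position_ge) fact
    ultimately show "(\<Sum>u\<in>{Suc t..Suc t + L}. d u) - ss_position \<pi> d t \<le> real L + 1 - Hlow"
      using assms by simp
  qed
  then have "b / T * (\<Sum>t<T. max 0 ((\<Sum>u\<in>{Suc t..Suc t + L}. d u) - ss_position \<pi> d t)) \<le>
     b / T * (\<Sum>t<T. real L + 1 - Hlow)"
    using assms by (intro mult_left_mono) auto
  also have "\<dots> \<le> b * (real L + 1 - Hlow)"
    using assms by (cases "T = 0") (auto)
  finally show "inv_loss 0 b 0 L T x1 \<pi> d \<le> b * (real L + 1 - Hlow)"
    using assms by (simp add: inv_loss_eq)
qed

section \<open>Measurability on the demand space\<close>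

lemma demand_component_measurable:
  assumes "t \<in> {1..n}"
  shows "(\<lambda>d. d t) \<in> borel_measurable (demand_space U n)"
proof -
  have "(\<lambda>d. d t) \<in> measurable (demand_space U n) (restrict_space borel {0..U})"
    unfolding demand_space_def using assms by (rule measurable_component_singleton)
  then show ?thesis by (simp add: measurable_restrict_space2_iff)
qed

lemma ss_position_measurable:
  "t \<le> n \<Longrightarrow> (\<lambda>d. ss_position \<pi> d t) \<in> borel_measurable (demand_space U n)"
proof (induction t)
  case (Suc t)
  have [measurable]: "(\<lambda>d. d (Suc t)) \<in> borel_measurable (demand_space U n)"
    using Suc.prems by (intro demand_component_measurable) auto
  have [measurable]: "(\<lambda>d. ss_position \<pi> d t) \<in> borel_measurable (demand_space U n)"
    using Suc by simp
  show ?case unfolding ss_position.simps Let_def by measurable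
qed simp

lemma inv_loss_measurable:
  assumes "x1 \<le> fst \<pi>"
  shows "inv_loss 0 b 0 L T x1 \<pi> \<in> borel_measurable (demand_space U (T + L))"
proof -
  have "(\<lambda>d. b / real T * (\<Sum>t<T. max 0 ((\<Sum>u\<in>{Suc t..Suc t + L}. d u) - ss_position \<pi> d t)))
    \<in> borel_measurable (demand_space U (T + L))"
    by (intro borel_measurable_times borel_measurable_sum borel_measurable_max
        borel_measurable_diff borel_measurable_const ss_position_measurable demand_component_measurable) auto
  moreover have "inv_loss 0 b 0 L T x1 \<pi> =
      (\<lambda>d. b / real T * (\<Sum>t<T. max 0 ((\<Sum>u\<in>{Suc t..Suc t + L}. d u) - ss_position \<pi> d t)))"
    using assms by (intro ext inv_loss_eq)
  ultimately show ?thesis by (simp only:)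
qed

lemma demand_space_singleton:
  assumes "x \<in> space (demand_space U n)"
  shows "{x} \<in> sets (demand_space U n)"
  unfolding demand_space_def
proof (rule sets_PiM_singleton)
  fix t assume "t \<in> {1..n}"
  then have "x t \<in> {0..U}"
    using assms by (auto simp: demand_space_def space_PiM space_restrict_space)
  then show "{x t} \<in> sets (restrict_space borel {0..U})"
    by (simp add: sets_restrict_space_iff)
qed (use assms in \<open>auto simp: demand_space_def\<close>)

section \<open>Loss when demand stops after \<open>n\<close> periods\<close>

lemma inv_loss_le_if_final_nonneg:
  assumes "x1 \<le> fst \<pi>" "- 1 \<le> fst \<pi>" "fst \<pi> \<le> snd \<pi>" "0 \<le> b"
    and d: "\<And>t. 1 \<le> t \<Longrightarrow> t \<le> T + L \<Longrightarrow> d t \<in> {0..1}"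
    and idle: "\<And>t. n < t \<Longrightarrow> t \<le> T + L \<Longrightarrow> d t = 0"
    and n: "n \<le> T" and fin: "fst \<pi> < ss_position \<pi> d n" "0 \<le> ss_position \<pi> d n"
  shows "inv_loss 0 b 0 L T x1 \<pi> d \<le> b * (real n * (real n + 1) / T)"
proof -
  have "(\<Sum>t<T. max 0 ((\<Sum>u\<in>{Suc t..Suc t + L}. d u) - ss_position \<pi> d t)) \<le>
      (\<Sum>t<T. if t < n then real n + 1 else 0)"
  proof (rule sum_mono)
    fix t assume t: "t \<in> {..<T}"
    show "max 0 ((\<Sum>u\<in>{Suc t..Suc t + L}. d u) - ss_position \<pi> d t) \<le> (if t < n then real n + 1 else 0)"
    proof (cases "t < n")
      case True
      have "(\<Sum>u\<in>{Suc t..Suc t + L}. d u) \<le> (\<Sum>u\<in>{Suc t..Suc t + L}. if u \<in> {1..n} then 1 else 0)"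
        using t d idle by (intro sum_mono) auto
      also have "\<dots> = real (card ({Suc t..Suc t + L} \<inter> {1..n}))"
        by (subst sum.inter_restrict[symmetric]) simp_all
      also have "\<dots> \<le> real n"
        using card_mono[of "{1..n}" "{Suc t..Suc t + L} \<inter> {1..n}"] by simp
      moreover have "fst \<pi> \<le> ss_position \<pi> d t"
        by (rule ss_position_ge) fact
      ultimately show ?thesis using True assms(2) by simp
    next
      case False
      have "(\<Sum>u\<in>{Suc t..Suc t + L}. d u) = 0"
        using False t idle by (intro sum.neutral) auto
      moreover have "ss_position \<pi> d (n + (t - n)) = ss_position \<pi> d n"
        using t False fin idle by (intro ss_position_idle) auto
      ultimately show ?thesis using False fin by simp
    qed
  qed
  also have "\<dots> = real n * (real n + 1)"
  proof -
    have "{..<T} \<inter> {t. t < n} = {..<n}" using n by auto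
    then show ?thesis by (simp add: sum.If_cases)
  qed
  finally have "b / T * (\<Sum>t<T. max 0 ((\<Sum>u\<in>{Suc t..Suc t + L}. d u) - ss_position \<pi> d t)) \<le>
      b / T * (real n * (real n + 1))"
    using assms by (intro mult_left_mono) auto
  then show ?thesis
    unfolding inv_loss_eq[OF assms(1)] by simp
qed

text \<open>From index \<open>n\<close> on the position is frozen, and its negative bounds the
  backlog from below; earlier terms are non-negative.\<close>

lemma inv_loss_ge_if_final_neg:
  assumes "x1 \<le> fst \<pi>" "0 \<le> b"
    and d: "\<And>t. 1 \<le> t \<Longrightarrow> t \<le> T + L \<Longrightarrow> 0 \<le> d t"
    and idle: "\<And>t. n < t \<Longrightarrow> t \<le> T + L \<Longrightarrow> d t = 0"
    and n: "n \<le> T" and fin: "fst \<pi> < ss_position \<pi> d n"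
  shows "b * ((real T - real n) / T * - ss_position \<pi> d n) \<le> inv_loss 0 b 0 L T x1 \<pi> d"
proof -
  have "(real T - real n) * - ss_position \<pi> d n = (\<Sum>t<T. if n \<le> t then - ss_position \<pi> d n else 0)"
  proof -
    have "{..<T} \<inter> {t. n \<le> t} = {n..<T}" by auto
    then show ?thesis using n by (simp add: sum.If_cases of_nat_diff)
  qed
  also have "\<dots> \<le> (\<Sum>t<T. max 0 ((\<Sum>u\<in>{Suc t..Suc t + L}. d u) - ss_position \<pi> d t))"
  proof (rule sum_mono)
    fix t assume t: "t \<in> {..<T}"
    have "0 \<le> (\<Sum>u\<in>{Suc t..Suc t + L}. d u)"
      using t d by (intro sum_nonneg) auto
    moreover have "ss_position \<pi> d (n + (t - n)) = ss_position \<pi> d n" if "n \<le> t"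
      using t that fin idle by (intro ss_position_idle) auto
    ultimately show "(if n \<le> t then - ss_position \<pi> d n else 0) \<le>
        max 0 ((\<Sum>u\<in>{Suc t..Suc t + L}. d u) - ss_position \<pi> d t)"
      by auto
  qed
  finally have "b / T * ((real T - real n) * - ss_position \<pi> d n) \<le>
      b / T * (\<Sum>t<T. max 0 ((\<Sum>u\<in>{Suc t..Suc t + L}. d u) - ss_position \<pi> d t))"
    using assms by (intro mult_left_mono) auto
  then show ?thesis
    unfolding inv_loss_eq[OF assms(1)] by (simp add: field_simps)
qed

subsection \<open>Shattered demand sequences\<close>

text \<open>The levels with a < M spread over less than 1/8, which is small against the distance 1/2
  of the two states. Block \<open>j\<close> therefore distinguishes levels in the same state only by
  comparing them with level \<open>j\<close>.\<close>

definition order_level :: "nat \<Rightarrow> nat \<Rightarrow> real" where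
  "order_level M a = real a / (8 * real M)"

text \<open>Block \<open>j\<close> occupies the periods \<open>2 + 3 * j, \<dots>, 4 + 3 * j\<close> and is active iff \<open>f\<close> changes
  between \<open>j\<close> and \<open>j + 1\<close>. Level \<open>a\<close> is swapped by the active blocks \<open>j \<ge> a\<close>, hence an even
  number of times iff \<open>f a = f M\<close>.\<close>

definition switch_demand :: "nat \<Rightarrow> (nat \<Rightarrow> bool) \<Rightarrow> nat \<Rightarrow> real" where
  "switch_demand M f t =
     (if t = 1 then 1 / 2
      else if t < 2 \<or> 2 + 3 * M \<le> t \<or> f ((t - 2) div 3) = f (Suc ((t - 2) div 3)) then 0
      else if t mod 3 = 2 then 1 / 2 + order_level M ((t - 2) div 3)
      else if t mod 3 = 0 then 5 / 8 else 1 / 2)"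

lemma order_level_bounds:
  assumes "a \<le> M"
  shows "0 \<le> order_level M a" "order_level M a \<le> 1 / 8"
  using assms by (auto simp: order_level_def divide_simps)

lemma order_level_le_iff:
  assumes "M > 0"
  shows "order_level M a \<le> order_level M a' \<longleftrightarrow> a \<le> a'"
  using assms by (simp add: order_level_def divide_simps)

lemma switch_demand_bounds: "switch_demand M f t \<in> {0..1}"
proof -
  have "(t - 2) div 3 \<le> M" if "t < 2 + 3 * M" using that by linarith
  then show ?thesis
    using order_level_bounds[of "(t - 2) div 3" M] by (auto simp: switch_demand_def)
qed

lemma switch_demand_block:
  assumes "j < M"
  shows "switch_demand M f (2 + 3 * j) = (if f j = f (Suc j) then 0 else 1 / 2 + order_level M j)"
    and "switch_demand M f (3 + 3 * j) = (if f j = f (Suc j) then 0 else 5 / 8)"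
    and "switch_demand M f (4 + 3 * j) = (if f j = f (Suc j) then 0 else 1 / 2)"
proof -
  have "(3 + 3 * j - 2) div 3 = j" "(4 + 3 * j - 2) div 3 = j" "(4 + 3 * j) mod 3 = 1"
    "(3 + 3 * j) mod 3 = 0" "(2 + 3 * j) mod 3 = 2"
    by presburger+
  with assms show "switch_demand M f (2 + 3 * j) = (if f j = f (Suc j) then 0 else 1 / 2 + order_level M j)"
    and "switch_demand M f (3 + 3 * j) = (if f j = f (Suc j) then 0 else 5 / 8)"
    and "switch_demand M f (4 + 3 * j) = (if f j = f (Suc j) then 0 else 1 / 2)"
    by (simp_all add: switch_demand_def)
qed

text \<open>Call S_a - 1/2 low and S_a high; index 1 + 3 j precedes block \<open>j\<close>. In an
  active block a low level a <= j reorders at the first and third demand and ends high, a low level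
  a > j reorders at the second only and ends low, and a high level a < j reorders at the second only
  and ends low. High levels a >= j do not occur.\<close>

lemma ss_position_switch_demand:
  assumes "a < M" "j \<le> M"
  shows "ss_position (- 1, order_level M a) (switch_demand M f) (1 + 3 * j) =
    order_level M a - (if j \<le> a \<or> f a = f j then 1 / 2 else 0)"
  using assms(2)
proof (induction j)
  case 0
  have "switch_demand M f (Suc 0) = 1 / 2" by (simp add: switch_demand_def)
  then show ?case using order_level_bounds[of a M] assms(1) by simp
next
  case (Suc j)
  let ?pos = "ss_position (- 1, order_level M a) (switch_demand M f)"
  have IH: "?pos (1 + 3 * j) = order_level M a - (if j \<le> a \<or> f a = f j then 1 / 2 else 0)"
    using Suc by simp
  have le: "order_level M a \<le> order_level M j \<longleftrightarrow> a \<le> j"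
    using assms(1) by (simp add: order_level_le_iff)
  have bnd: "0 \<le> order_level M a" "order_level M a \<le> 1 / 8"
    "0 \<le> order_level M j" "order_level M j \<le> 1 / 8"
    using order_level_bounds[of a M] order_level_bounds[of j M] assms(1) Suc.prems by auto
  have "j < M" using Suc.prems by simp
  note blk = switch_demand_block[OF this, of f]
  have step: "?pos k = (if ?pos i - switch_demand M f k \<le> - 1 then order_level M a
      else ?pos i - switch_demand M f k)" if "k = Suc i" for i k
    by (simp add: that Let_def)
  have step1: "?pos (2 + 3 * j) = (if ?pos (1 + 3 * j) - switch_demand M f (2 + 3 * j) \<le> - 1
      then order_level M a else ?pos (1 + 3 * j) - switch_demand M f (2 + 3 * j))"
    and step2: "?pos (3 + 3 * j) = (if ?pos (2 + 3 * j) - switch_demand M f (3 + 3 * j) \<le> - 1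
      then order_level M a else ?pos (2 + 3 * j) - switch_demand M f (3 + 3 * j))"
    and step3: "?pos (1 + 3 * Suc j) = (if ?pos (3 + 3 * j) - switch_demand M f (4 + 3 * j) \<le> - 1
      then order_level M a else ?pos (3 + 3 * j) - switch_demand M f (4 + 3 * j))"
    by (rule step, simp)+ (subst step[of "4 + 3 * j" "3 + 3 * j", symmetric], simp_all)
  \<comment> \<open>In an inactive block the description changes form only for a = j, where
    \<open>j \<le> a\<close> gives way to \<open>f a = f (Suc j)\<close>.\<close>
  have eq: "f a = f j" if "j \<le> a" "a < Suc j"
    using that by (simp add: less_Suc_eq_le le_antisym)
  show ?case
  proof (cases "f j = f (Suc j)")
    case True
    then show ?thesis
      using bnd eq Suc.prems unfolding step3 step2 step1 IH blk
      by (auto simp: le_Suc_eq not_le)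
  next
    case False
    then show ?thesis
      using bnd Suc.prems le unfolding step3 step2 step1 IH blk
      by (auto simp: le_Suc_eq not_le)
  qed
qed

text \<open>Allows passing from \<open>switch_demand\<close> to its restriction, as elements of the
  demand space are extensional.\<close>

lemma inv_loss_cong:
  assumes "x1 \<le> fst \<pi>" "\<And>t. 1 \<le> t \<Longrightarrow> t \<le> T + L \<Longrightarrow> d t = d' t"
  shows "inv_loss 0 b 0 L T x1 \<pi> d = inv_loss 0 b 0 L T x1 \<pi> d'"
proof -
  have "sum d {Suc t..Suc t + L} = sum d' {Suc t..Suc t + L}"
    "ss_position \<pi> d t = ss_position \<pi> d' t" if "t < T" for t
    using assms(2) that by (auto intro!: sum.cong ss_position_cong)
  then show ?thesis
    unfolding inv_loss_eq[OF assms(1)] by simp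
qed

text \<open>As \<open>f M\<close> holds, level \<open>a\<close> ends low iff \<open>f a\<close>. A
  low end costs at least 3/8 b in at least 15/16 of the terms, and 15/16 * 3/8 = 45/128. With a high
  end only the initial phase costs anything, at most b n (n + 1) / T.\<close>

lemma inv_loss_switch_demand:
  fixes L T M :: nat and b x1 :: real
  assumes "x1 \<le> - 1" "0 \<le> b" "a < M" and T: "320 * M\<^sup>2 \<le> T" and final: "f M"
  defines "l \<equiv> inv_loss 0 b 0 L T x1 (- 1, order_level M a) (switch_demand M f)"
  shows "f a \<Longrightarrow> b * (45 / 128) \<le> l" and "\<not> f a \<Longrightarrow> l \<le> b / 16"
proof -
  let ?\<pi> = "(- 1, order_level M a)" and ?d = "switch_demand M f"
  define n where "n = 1 + 3 * M"
  have pos: "ss_position ?\<pi> ?d n = order_level M a - (if f a then 1 / 2 else 0)"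
    using ss_position_switch_demand[of a M M f] assms by (simp add: n_def)
  have bnd: "0 \<le> order_level M a" "order_level M a \<le> 1 / 8"
    using order_level_bounds[of a M] assms(3) by auto
  have idle: "?d t = 0" if "n < t" for t
    using that by (simp add: switch_demand_def n_def)
  \<comment> \<open>Here n <= 4 M and n + 1 <= 5 M because M >= 1, whence 320 = 16 * 4 * 5.\<close>
  have "n * (n + 1) \<le> (4 * M) * (5 * M)"
    using assms(3) unfolding n_def by (intro mult_le_mono) auto
  also have "16 * \<dots> = 320 * M\<^sup>2" by (simp add: power2_eq_square)
  finally have "16 * (n * (n + 1)) \<le> T" using T by linarith
  then have "real (16 * (n * (n + 1))) \<le> real T" by (simp only: of_nat_le_iff)
  then have nT: "16 * (real n * (real n + 1)) \<le> T" by (simp add: algebra_simps)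
  have n1: "real n \<ge> 1" by (simp add: n_def)
  have "real n * 1 \<le> real n * (real n + 1)" by (intro mult_left_mono) auto
  then have nT': "16 * real n \<le> T" using nT by linarith
  have Tpos: "real T > 0" using n1 nT' by linarith
  show "b * (45 / 128) \<le> l" if "f a"
  proof -
    have "15 / 16 * (3 / 8) \<le> (real T - real n) / T * - ss_position ?\<pi> ?d n"
      using bnd that nT' Tpos unfolding pos by (intro mult_mono) (auto simp: field_simps)
    then have "b * (45 / 128) \<le> b * ((real T - real n) / T * - ss_position ?\<pi> ?d n)"
      using assms by (intro mult_left_mono) auto
    also have "\<dots> \<le> l"
      unfolding l_def
    proof (rule inv_loss_ge_if_final_neg)
      show "n \<le> T" using nT' by linarith
    qed (use assms bnd that pos idle switch_demand_bounds[of M f] in auto)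
    finally show ?thesis .
  qed
  show "l \<le> b / 16" if "\<not> f a"
  proof -
    have "l \<le> b * (real n * (real n + 1) / T)"
      unfolding l_def
    proof (rule inv_loss_le_if_final_nonneg)
      show "n \<le> T" using nT' by linarith
    qed (use assms bnd that pos idle switch_demand_bounds[of M f] in auto)
    also have "\<dots> \<le> b * (1 / 16)"
      using nT Tpos assms by (intro mult_left_mono) (auto simp: field_simps)
    finally show ?thesis by simp
  qed
qed

text \<open>Each subset of \<open>{1..m}\<close> gets one of 2^m levels, and sequence
  \<open>i\<close> is driven by membership of \<open>i\<close> in these subsets. The policy for
  \<open>A\<close> is the level assigned to \<open>A\<close>.\<close>

lemma ss_policies_shatter:
  assumes "0 \<le> b" "Hlow \<le> - 1" "x1 \<le> Hlow" and T: "4 ^ (m + 5) \<le> T"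
  obtains ds :: "nat \<Rightarrow> nat \<Rightarrow> real" where
    "\<And>i. ds i \<in> space (demand_space 1 (T + L))"
    "\<And>A. A \<subseteq> {1..m} \<Longrightarrow> \<exists>\<pi>\<in>ss_policies Hlow \<infinity>.
       (\<forall>i\<in>A. inv_loss 0 b 0 L T x1 \<pi> (ds i) \<ge> b * (45 / 128)) \<and>
       (\<forall>i\<in>{1..m} - A. inv_loss 0 b 0 L T x1 \<pi> (ds i) \<le> b / 16)"
proof -
  define M :: nat where "M = 2 ^ m"
  have "card (Pow {1..m}) = M" by (simp add: card_Pow M_def)
  then obtain e where e: "bij_betw e {0..<M} (Pow {1..m})"
    using ex_bij_betw_nat_finite[of "Pow {1..m}"] by auto
  \<comment> \<open>Index \<open>M\<close> carries no subset; its value True is the reference for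
    the final states.\<close>
  define f where "f i k \<longleftrightarrow> k = M \<or> i \<in> e k" for i k
  define ds where "ds i = restrict (switch_demand M (f i)) {1..T + L}" for i
  have "M\<^sup>2 = (2\<^sup>2) ^ m" unfolding M_def by (metis power_mult mult.commute)
  then have "320 * M\<^sup>2 \<le> 4 ^ (m + 5)" by (simp add: power_add)
  then have T': "320 * M\<^sup>2 \<le> T" using T by linarith
  show ?thesis
  proof (rule that[of ds])
    show "ds i \<in> space (demand_space 1 (T + L))" for i
      using switch_demand_bounds[of M "f i"]
      by (auto simp: ds_def demand_space_def space_PiM space_restrict_space)
  next
    fix A assume A: "A \<subseteq> {1..m}"
    then have "A \<in> e ` {0..<M}" using e by (auto simp: bij_betw_def)
    then obtain a where a: "a < M" "e a = A" by auto
    let ?\<pi> = "(- 1, order_level M a)"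
    have "?\<pi> \<in> ss_policies Hlow \<infinity>"
      using assms order_level_bounds[of a M] a by (auto simp: ss_policies_def)
    moreover have "inv_loss 0 b 0 L T x1 ?\<pi> (ds i) = inv_loss 0 b 0 L T x1 ?\<pi> (switch_demand M (f i))" for i
      using assms by (intro inv_loss_cong) (auto simp: ds_def)
    moreover have "f i M" "f i a \<longleftrightarrow> i \<in> A" for i
      using a by (auto simp: f_def)
    ultimately show "\<exists>\<pi>\<in>ss_policies Hlow \<infinity>.
       (\<forall>i\<in>A. inv_loss 0 b 0 L T x1 \<pi> (ds i) \<ge> b * (45 / 128)) \<and>
       (\<forall>i\<in>{1..m} - A. inv_loss 0 b 0 L T x1 \<pi> (ds i) \<le> b / 16)"
      using inv_loss_switch_demand[of x1 b a M T, OF _ _ a(1) T'] assms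
      by (intro bexI[of _ ?\<pi>]) auto
  qed
qed

section \<open>Comparison of rates and conclusion\<close>

text \<open>Since ln T <= 6 m and ln (ln T) >= 1, the left radicand is at most 6 m / N, hence at
  most 64 m / (10 N); the constant 1/8 is 1 / sqrt 64.\<close>

lemma sqrt_log_rate_le:
  assumes T: "(4::nat) ^ (m + 5) \<le> T" "T < 4 ^ (m + 6)" and m: "m \<ge> 5" and N: "N \<ge> 1"
  shows "1 / 8 * sqrt (ln (real T) / (real N * ln (ln (real T)))) \<le> sqrt (real m / (10 * real N))"
proof -
  have "(4::nat) ^ 3 \<le> 4 ^ (m + 5)" by (rule power_increasing) auto
  then have "real (4 ^ 3) \<le> real T" using T by (simp only: of_nat_le_iff)
  then have T64: "real T \<ge> 64" by simp
  have "exp (3::real) = exp 1 ^ 3" by (simp flip: exp_of_nat_mult)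
  also have "\<dots> \<le> 3 ^ 3" by (intro power_mono exp_le) auto
  finally have "exp 3 \<le> real T" using T64 by simp
  then have ln3: "ln (real T) \<ge> 3" using T64 by (subst ln_ge_iff) auto
  then have "exp 1 \<le> ln (real T)" using exp_le by linarith
  then have lnln: "ln (ln (real T)) \<ge> 1" using ln3 by (subst ln_ge_iff) auto
  have "real T \<le> real (4 ^ (m + 6))" using T by (simp only: of_nat_le_iff)
  then have "ln (real T) \<le> ln (4 ^ (m + 6))" using T64 by simp
  also have "\<dots> = real (m + 6) * ln 4" by (rule ln_realpow)
  also have "\<dots> = 2 * real (m + 6) * ln 2" using ln_realpow[of 2 2] by simp
  also have "\<dots> \<le> 2 * real (m + 6) * 1" using ln_2_less_1 by (intro mult_left_mono) auto
  also have "\<dots> \<le> 6 * real m" using m by simp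
  finally have ln_le: "ln (real T) \<le> 6 * real m" .
  have "ln (real T) / (real N * ln (ln (real T))) \<le> 6 * real m / (real N * 1)"
    using ln_le lnln N by (intro frac_le mult_left_mono) auto
  also have "\<dots> \<le> 64 * (real m / (10 * real N))"
    using N by (simp add: field_simps)
  finally have "sqrt (ln (real T) / (real N * ln (ln (real T)))) \<le> sqrt (8\<^sup>2 * (real m / (10 * real N)))"
    by (intro real_sqrt_le_mono) simp
  then show ?thesis by (simp add: real_sqrt_mult del: times_divide_eq_right)
qed

theorem corollary3:
  "\<exists>C>0. \<exists>T0>0. \<forall>(b::real) (L::nat) (T::nat) (\<gamma>::real) (Hlow::real) (x1::real).
     0 < b \<longrightarrow> b \<le> 1 / 2 \<longrightarrow> T0 \<le> T \<longrightarrow> 0 < \<gamma> \<longrightarrow> \<gamma> \<le> b / 16 \<longrightarrow>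
     Hlow \<le> - 1 \<longrightarrow> x1 \<le> 0 \<longrightarrow> x1 \<le> Hlow \<longrightarrow>
     (\<exists>D. prob_space D \<and> sets D = sets (demand_space 1 (T + L)) \<and>
        (\<forall>N\<ge>1.
           pseudo_dim \<gamma> (space (demand_space 1 (T + L))) (ss_policies Hlow \<infinity>)
             (inv_loss 0 b 0 L T x1) \<le> enat N \<longrightarrow>
           expected_gen_error (ss_policies Hlow \<infinity>) (inv_loss 0 b 0 L T x1) D N
             \<ge> C * \<gamma> * sqrt (ln (real T) / (real N * ln (ln (real T))))))"
proof (rule exI[of _ "1 / 8"], intro conjI, simp, rule exI[of _ "4 ^ 10"], intro conjI, simp, intro allI impI)
  fix b :: real and L T :: nat and \<gamma> Hlow x1 :: real
  assume b: "0 < b" "b \<le> 1 / 2" and T0: "4 ^ 10 \<le> T" and \<gamma>: "0 < \<gamma>" "\<gamma> \<le> b / 16"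
    and H: "Hlow \<le> - 1" "x1 \<le> 0" "x1 \<le> Hlow"
  let ?X = "demand_space 1 (T + L)" and ?P = "ss_policies Hlow \<infinity>" and ?f = "inv_loss 0 b 0 L T x1"
  have "T > 0" using T0 by (intro gr0I) auto
  then obtain k where k: "4 ^ k \<le> T" "T < 4 ^ (k + 1)"
    using ex_power_ivl1[of 4 T] by auto
  \<comment> \<open>The choice of \<open>T0\<close> gives k >= 10, so m = k - 5 is at least 5, as
    the comparison of rates requires.\<close>
  have "(4::nat) ^ 10 < 4 ^ (k + 1)" using T0 k by linarith
  then have "10 < k + 1" by (rule power_less_imp_less_exp[rotated]) simp
  then obtain m where m: "k = m + 5" "m \<ge> 5"
    by (intro that[of "k - 5"]) auto
  have T: "4 ^ (m + 5) \<le> T" "T < 4 ^ (m + 6)" using k m by (simp_all add: add.commute)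
  obtain ds where ds: "\<And>i. ds i \<in> space ?X"
    and split: "\<And>A. A \<subseteq> {1..m} \<Longrightarrow> \<exists>\<pi>\<in>?P.
       (\<forall>i\<in>A. ?f \<pi> (ds i) \<ge> b * (45 / 128)) \<and> (\<forall>i\<in>{1..m} - A. ?f \<pi> (ds i) \<le> b / 16)"
    using ss_policies_shatter[of b Hlow x1 m T L] b H T by (metis less_imp_le)
  define J where "J = ds ` {1..m}"
  \<comment> \<open>Equal sequences would have a loss that is both at least 45/128 b and at most b /
    16. Hence the distribution has m distinct atoms.\<close>
  have inj: "inj_on ds {1..m}"
  proof (rule inj_onI, rule ccontr)
    fix i j assume ij: "i \<in> {1..m}" "j \<in> {1..m}" "ds i = ds j" "i \<noteq> j"
    then obtain \<pi> where "?f \<pi> (ds i) \<ge> b * (45 / 128)" "?f \<pi> (ds j) \<le> b / 16"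
      using split[of "{i}"] by auto
    then show False using ij b by simp
  qed
  then have card_J: "card J = m" by (simp add: J_def card_image)
  have J: "finite J" "J \<noteq> {}" "J \<subseteq> space ?X" "\<And>x. x \<in> J \<Longrightarrow> {x} \<in> sets ?X"
    using m ds by (auto simp: J_def intro: demand_space_singleton)
  have shat: "shattered \<gamma> ?P ?f m ds"
    unfolding shattered_def
  \<comment> \<open>As \<open>\<gamma> \<le> b / 16\<close>, the margins around 3/16 b lie in
    [b / 8, b / 4], strictly between b / 16 and 45/128 b.\<close>
  proof (rule exI[of _ "\<lambda>_. 3 / 16 * b"], intro allI impI)
    fix A assume "A \<subseteq> {1..m}"
    then obtain \<pi> where \<pi>: "\<pi> \<in> ?P" "\<forall>i\<in>A. ?f \<pi> (ds i) \<ge> b * (45 / 128)"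
        "\<forall>i\<in>{1..m} - A. ?f \<pi> (ds i) \<le> b / 16"
      using split by blast
    have "\<forall>i\<in>A. 3 / 16 * b + \<gamma> < ?f \<pi> (ds i)" "\<forall>i\<in>{1..m} - A. ?f \<pi> (ds i) \<le> 3 / 16 * b - \<gamma>"
      using \<pi>(2,3) b \<gamma> by force+
    then show "\<exists>\<pi>\<in>?P. (\<forall>i\<in>A. 3 / 16 * b + \<gamma> < ?f \<pi> (ds i)) \<and>
        (\<forall>i\<in>{1..m} - A. ?f \<pi> (ds i) \<le> 3 / 16 * b - \<gamma>)"
      using \<pi>(1) by blast
  qed
  have P: "x1 \<le> fst \<pi>" "Hlow \<le> fst \<pi>" "fst \<pi> \<le> snd \<pi>" if "\<pi> \<in> ?P" for \<pi>
    using that H by (auto simp: ss_policies_def)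
  show "\<exists>D. prob_space D \<and> sets D = sets ?X \<and>
        (\<forall>N\<ge>1. pseudo_dim \<gamma> (space ?X) ?P ?f \<le> enat N \<longrightarrow>
           expected_gen_error ?P ?f D N \<ge> 1 / 8 * \<gamma> * sqrt (ln (real T) / (real N * ln (ln (real T)))))"
  proof (intro exI conjI allI impI)
    show "prob_space (uniform_on ?X J)" "sets (uniform_on ?X J) = sets ?X"
      using J by (simp_all add: prob_space_uniform_on sets_uniform_on)
    fix N :: nat assume N: "N \<ge> 1" "pseudo_dim \<gamma> (space ?X) ?P ?f \<le> enat N"
    \<comment> \<open>The shattered sequences bound the dimension from below, so the sample size is
      at least the number of atoms, as the deviation bound requires.\<close>
    have "enat m \<le> pseudo_dim \<gamma> (space ?X) ?P ?f"
      unfolding pseudo_dim_def using ds shat by (intro Sup_upper) auto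
    then have "enat m \<le> enat N" using N(2) by (rule order_trans)
    then have mN: "m \<le> N" by simp
    have "1 / 8 * \<gamma> * sqrt (ln (real T) / (real N * ln (ln (real T)))) \<le> \<gamma> * sqrt (real m / (10 * real N))"
      using mult_left_mono[OF sqrt_log_rate_le[OF T m(2) N(1)], of \<gamma>] \<gamma> by simp
    also have "\<dots> \<le> expected_gen_error ?P ?f (uniform_on ?X J) N"
      unfolding card_J[symmetric]
    proof (rule expected_gen_error_ge[OF J, where \<tau> = "\<lambda>_. 3 / 16 * b" and B = "b * (real L + 1 - Hlow)"])
      fix \<pi> assume "\<pi> \<in> ?P"
      then show "?f \<pi> \<in> borel_measurable ?X"
        using P by (intro inv_loss_measurable) auto
      fix x assume "x \<in> J"
      then have "x \<in> space ?X" using J by auto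
      then have "x t \<in> {0..1}" if "1 \<le> t" "t \<le> T + L" for t
        using that by (auto simp: demand_space_def space_PiM space_restrict_space)
      then show "\<bar>?f \<pi> x\<bar> \<le> b * (real L + 1 - Hlow)"
        using inv_loss_bounds[OF P[OF \<open>\<pi> \<in> ?P\<close>], of b T L x] b H by (simp add: add.commute)
    next
      fix A assume "A \<subseteq> J"
      have "{i \<in> {1..m}. ds i \<in> A} \<subseteq> {1..m}" by blast
      from split[OF this] obtain \<pi> where \<pi>: "\<pi> \<in> ?P" "\<forall>i\<in>{i \<in> {1..m}. ds i \<in> A}. ?f \<pi> (ds i) \<ge> b * (45 / 128)"
        "\<forall>i\<in>{1..m} - {i \<in> {1..m}. ds i \<in> A}. ?f \<pi> (ds i) \<le> b / 16"
        by blast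
      then have "\<forall>x\<in>A. 3 / 16 * b + \<gamma> \<le> ?f \<pi> x" "\<forall>x\<in>J - A. ?f \<pi> x \<le> 3 / 16 * b - \<gamma>"
        using b \<gamma> \<open>A \<subseteq> J\<close> unfolding J_def by force+
      then show "\<exists>\<pi>\<in>?P. (\<forall>x\<in>A. 3 / 16 * b + \<gamma> \<le> ?f \<pi> x) \<and> (\<forall>x\<in>J - A. ?f \<pi> x \<le> 3 / 16 * b - \<gamma>)"
        using \<pi>(1) by blast
    qed (use m mN card_J \<gamma> in auto)
    finally show "1 / 8 * \<gamma> * sqrt (ln (real T) / (real N * ln (ln (real T)))) \<le>
        expected_gen_error ?P ?f (uniform_on ?X J) N" .
  qed
qed

end
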